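(* For every $n\in\mathbb{N}$, the polyomino $P(n,1,1,0)$ has the Rectangle profile if $n\le 3$ and the Bent strip profile if $n\ge 4$.
   Context: Let $\mathbb{N}=\{0,1,2,\dots\}$. Cells of the square grid are identified with points of $\mathbb{Z}^2$. For $a,b,c,d\in\mathbb{N}$ define $$P(a,b,c,d)=\{(x,0):-c\le x\le a\}\cup\{(0,y):-d\le y\le b\}\subset\mathbb{Z}^2 .$$ A copy of a polyomino is an integer translate of any of its eight images under square-grid rotations and reflections. A tiling of a region $\Omega\subseteq\mathbb{Z}^2$ is an arbitrary (possibly infinite, not necessarily periodic) collection of copies, each contained in $\Omega$, pairwise disjoint as sets of cells, whose union is $\Omega$. A polyomino has capability: - $\mathrm{R}$ if for some integers $u,v\ge 1$ it tiles the rectangle $\{0,\dots,u-1\}\times\{0,\dots,v-1\}$; - $\mathrm{HS}$ (half-strip) if for some integer $w\ge 1$ it tiles $\mathbb{N}\times\{0,\dots,w-1\}$; - $\mathrm{BS}$ (bent strip) if for some integers $u,v\ge 1$ it tiles $\{(x,y)\in\mathbb{N}^2: x<u\text{ or }y<v\}$; - $\mathrm{Q}$ if it tiles the quadrant $\mathbb{N}^2$; - $\mathrm{S}$ if for some integer $w\ge 1$ it tiles the strip $\mathbb{Z}\times\{0,\dots,w-1\}$; - $\mathrm{HP}$ if it tiles the half-plane $\mathbb{Z}\times\mathbb{N}$; - $\mathrm{Plane}$ if it tiles $\mathbb{Z}^2$; - $\mathrm{Rep}$ if for some integer $k\ge 2$ its copies tile the enlargement obtained by replacing every cell $(x,y)$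 of the polyomino by the $k\times k$ block $\{kx,\dots,kx+k-1\}\times\{ky,\dots,ky+k-1\}$. Rectangle profile: all eight capabilities hold. Bent strip profile: exactly $\mathrm{BS},\mathrm{Q},\mathrm{S},\mathrm{HP},\mathrm{Plane}$ hold, while $\mathrm{R}$, $\mathrm{Rep}$ and $\mathrm{HS}$ fail. *)

theory Defs
  imports Main
begin

type_synonym cell = "int \<times> int"

definition cross :: "nat \<Rightarrow> nat \<Rightarrow> nat \<Rightarrow> nat \<Rightarrow> cell set" where
  "cross a b c d =
     {(x, 0) | x. - int c \<le> x \<and> x \<le> int a} \<union> {(0, y) | y. - int d \<le> y \<and> y \<le> int b}"

definition grid_symmetries :: "(cell \<Rightarrow> cell) set" where
  "grid_symmetries =
     {\<lambda>(x, y). (x, y), \<lambda>(x, y). (- y, x), \<lambda>(x, y). (- x, - y), \<lambda>(x, y). (y, - x),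
      \<lambda>(x, y). (- x, y), \<lambda>(x, y). (x, - y), \<lambda>(x, y). (y, x), \<lambda>(x, y). (- y, - x)}"

definition is_copy :: "cell set \<Rightarrow> cell set \<Rightarrow> bool" where
  "is_copy p q \<longleftrightarrow> (\<exists>f \<in> grid_symmetries. \<exists>s t. q = (\<lambda>(x, y). (x + s, y + t)) ` f ` p)"

text \<open>A collection of copies is a set of cell sets: pairwise disjoint copies of a nonempty
  polyomino are distinct, so no indexing is needed.\<close>

definition is_tiling :: "cell set \<Rightarrow> cell set \<Rightarrow> cell set set \<Rightarrow> bool" where
  "is_tiling p \<Omega> T \<longleftrightarrow> (\<forall>q \<in> T. is_copy p q \<and> q \<subseteq> \<Omega>) \<and> pairwise disjnt T \<and> \<Union> T = \<Omega>"

definition tiles :: "cell set \<Rightarrow> cell set \<Rightarrow> bool" where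
  "tiles p \<Omega> \<longleftrightarrow> (\<exists>T. is_tiling p \<Omega> T)"

definition enlargement :: "int \<Rightarrow> cell set \<Rightarrow> cell set" where
  "enlargement k p = (\<Union>(x, y) \<in> p. {k * x .. k * x + k - 1} \<times> {k * y .. k * y + k - 1})"

definition tiles_rectangle :: "cell set \<Rightarrow> bool" where
  "tiles_rectangle p \<longleftrightarrow> (\<exists>u v. u \<ge> 1 \<and> v \<ge> 1 \<and> tiles p ({0 .. u - 1} \<times> {0 .. v - 1}))"

definition tiles_half_strip :: "cell set \<Rightarrow> bool" where
  "tiles_half_strip p \<longleftrightarrow> (\<exists>w. w \<ge> 1 \<and> tiles p ({0 ..} \<times> {0 .. w - 1}))"

definition tiles_bent_strip :: "cell set \<Rightarrow> bool" where
  "tiles_bent_strip p \<longleftrightarrow>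
     (\<exists>u v. u \<ge> 1 \<and> v \<ge> 1 \<and> tiles p {(x, y). 0 \<le> x \<and> 0 \<le> y \<and> (x < u \<or> y < v)})"

definition tiles_quadrant :: "cell set \<Rightarrow> bool" where
  "tiles_quadrant p \<longleftrightarrow> tiles p ({0 ..} \<times> {0 ..})"

definition tiles_strip :: "cell set \<Rightarrow> bool" where
  "tiles_strip p \<longleftrightarrow> (\<exists>w. w \<ge> 1 \<and> tiles p (UNIV \<times> {0 .. w - 1}))"

definition tiles_half_plane :: "cell set \<Rightarrow> bool" where
  "tiles_half_plane p \<longleftrightarrow> tiles p (UNIV \<times> {0 ..})"

definition tiles_plane :: "cell set \<Rightarrow> bool" where
  "tiles_plane p \<longleftrightarrow> tiles p UNIV"

definition tiles_enlargement :: "cell set \<Rightarrow> bool" where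
  "tiles_enlargement p \<longleftrightarrow> (\<exists>k. k \<ge> 2 \<and> tiles p (enlargement k p))"

definition rectangle_profile :: "cell set \<Rightarrow> bool" where
  "rectangle_profile p \<longleftrightarrow>
     tiles_rectangle p \<and> tiles_half_strip p \<and> tiles_bent_strip p \<and> tiles_quadrant p \<and>
     tiles_strip p \<and> tiles_half_plane p \<and> tiles_plane p \<and> tiles_enlargement p"

definition bent_strip_profile :: "cell set \<Rightarrow> bool" where
  "bent_strip_profile p \<longleftrightarrow>
     tiles_bent_strip p \<and> tiles_quadrant p \<and> tiles_strip p \<and> tiles_half_plane p \<and> tiles_plane p \<and>
     \<not> tiles_rectangle p \<and> \<not> tiles_enlargement p \<and> \<not> tiles_half_strip p"

end

theory Submission
  imports Defs "HOL-Library.Product_Lexorder"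
begin

text \<open>Write \<open>L = n + 2\<close> for the length of the bar, so that the bump sits on the second cell from one
  of its ends. Two interlocked copies fill a block of \<open>2 (L + 1)\<close> cells whose translates fill a strip
  of width 2 and, bent at a corner, a bent strip of width 2. A tiling of a rectangle yields every
  capability, and rectangles of sizes \<open>2 \<times> 3\<close>, \<open>4 \<times> 4\<close>, \<open>5 \<times> 10\<close> and \<open>23 \<times> 24\<close> exist for
  \<open>n = 0, 1, 2, 3\<close>.

  For \<open>L \<ge> 6\<close> consider a half-strip going upwards. Three consecutive cells whose lower neighbours
  belong to older copies cannot all be covered by upright bars or downward bumps, so a horizontal
  bar starts there. On top of a horizontal bar there are always three such cells (\<open>L - 3 \<ge> 3\<close>), so every
  row contains a horizontal bar, each overlapping the one in the row below in some column. Along the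
  right side of an upright bar to the left of this chain at most two of four consecutive rows can be
  filled by horizontal bars starting there, which forces another upright bar at most two
  columns further right and still left of the chain. Hence upright bars move right without bound,
  which is absurd. The argument needs only a bounded part of the half-strip, so it applies to the end
  of an arm of the enlarged polyomino as well.\<close>

section \<open>Copies, motions and unions of tilings\<close>

text \<open>Up to the signs of the coordinates only the choice of swapping them remains, so two
  signs and one alternative replace eight symmetries in later case splits.\<close>

lemma is_copy_iff:
  "is_copy p q \<longleftrightarrow> (\<exists>a b s t. (a = 1 \<or> a = - 1) \<and> (b = 1 \<or> b = - 1) \<and>
     (q = (\<lambda>(x, y). (a * x + s, b * y + t)) ` p \<or> q = (\<lambda>(x, y). (a * y + s, b * x + t)) ` p))"
  (is "?L \<longleftrightarrow> ?R")
proof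
  assume ?L
  then obtain f s t where f: "f \<in> grid_symmetries" and q: "q = (\<lambda>(x, y). (x + s, y + t)) ` f ` p"
    by (auto simp: is_copy_def)
  from f obtain a b :: int where ab: "a = 1 \<or> a = - 1" "b = 1 \<or> b = - 1"
    and f': "f = (\<lambda>(x, y). (a * x, b * y)) \<or> f = (\<lambda>(x, y). (a * y, b * x))"
    unfolding grid_symmetries_def
    by (elim insertE emptyE) (force simp: fun_eq_iff)+
  from f' have "q = (\<lambda>(x, y). (a * x + s, b * y + t)) ` p \<or> q = (\<lambda>(x, y). (a * y + s, b * x + t)) ` p"
    unfolding q by (elim disjE) (simp_all add: image_image case_prod_beta)
  with ab show ?R by blast
next
  assume ?R
  then obtain a b s t where ab: "a = 1 \<or> a = - 1" "b = 1 \<or> b = - 1" and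
    q: "q = (\<lambda>(x, y). (a * x + s, b * y + t)) ` p \<or> q = (\<lambda>(x, y). (a * y + s, b * x + t)) ` p" by blast
  have "(\<lambda>(x, y). (a * x, b * y)) \<in> grid_symmetries" "(\<lambda>(x, y). (a * y, b * x)) \<in> grid_symmetries"
    using ab by (auto simp: grid_symmetries_def)
  moreover have "q = (\<lambda>(x, y). (x + s, y + t)) ` (\<lambda>(x, y). (a * x, b * y)) ` p \<or>
     q = (\<lambda>(x, y). (x + s, y + t)) ` (\<lambda>(x, y). (a * y, b * x)) ` p"
    using q by (simp add: image_image case_prod_beta)
  ultimately show ?L unfolding is_copy_def by blast
qed

text \<open>A sign is its own inverse, so the inverse motion is explicit.\<close>

lemma mem_motion:
  fixes a b :: int
  assumes "a = 1 \<or> a = - 1" "b = 1 \<or> b = - 1"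
  shows "(u, v) \<in> (\<lambda>(x, y). (a * x + s, b * y + t)) ` A \<longleftrightarrow> (a * (u - s), b * (v - t)) \<in> A"
    and "(u, v) \<in> (\<lambda>(x, y). (a * y + s, b * x + t)) ` A \<longleftrightarrow> (b * (v - t), a * (u - s)) \<in> A"
  using assms by (force simp: image_iff)+

lemma is_copy_motion:
  assumes q: "is_copy p q" and ab: "a = 1 \<or> a = - 1" "b = 1 \<or> b = - 1"
    and \<phi>: "\<phi> = (\<lambda>(x, y). (a * x + s, b * y + t)) \<or> \<phi> = (\<lambda>(x, y). (a * y + s, b * x + t))"
  shows "is_copy p (\<phi> ` q)"
proof -
  obtain c d s' t' where cd: "c = 1 \<or> c = - 1" "d = 1 \<or> d = - 1" and
    q: "q = (\<lambda>(x, y). (c * x + s', d * y + t')) ` p \<or> q = (\<lambda>(x, y). (c * y + s', d * x + t')) ` p"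
    using q unfolding is_copy_iff by blast
  have signs: "a * c = 1 \<or> a * c = - 1" "b * d = 1 \<or> b * d = - 1" "a * d = 1 \<or> a * d = - 1" "b * c = 1 \<or> b * c = - 1"
    using ab cd by auto
  from \<phi> q show ?thesis
  proof (elim disjE)
    assume "\<phi> = (\<lambda>(x, y). (a * x + s, b * y + t))" "q = (\<lambda>(x, y). (c * x + s', d * y + t')) ` p"
    then have "\<phi> ` q = (\<lambda>(x, y). (a * c * x + (a * s' + s), b * d * y + (b * t' + t))) ` p"
      by (simp add: image_image case_prod_beta algebra_simps)
    then show ?thesis unfolding is_copy_iff using signs by blast
  next
    assume "\<phi> = (\<lambda>(x, y). (a * x + s, b * y + t))" "q = (\<lambda>(x, y). (c * y + s', d * x + t')) ` p"
    then have "\<phi> ` q = (\<lambda>(x, y). (a * c * y + (a * s' + s), b * d * x + (b * t' + t))) ` p"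
      by (simp add: image_image case_prod_beta algebra_simps)
    then show ?thesis unfolding is_copy_iff using signs by blast
  next
    assume "\<phi> = (\<lambda>(x, y). (a * y + s, b * x + t))" "q = (\<lambda>(x, y). (c * x + s', d * y + t')) ` p"
    then have "\<phi> ` q = (\<lambda>(x, y). (a * d * y + (a * t' + s), b * c * x + (b * s' + t))) ` p"
      by (simp add: image_image case_prod_beta algebra_simps)
    then show ?thesis unfolding is_copy_iff using signs by blast
  next
    assume "\<phi> = (\<lambda>(x, y). (a * y + s, b * x + t))" "q = (\<lambda>(x, y). (c * y + s', d * x + t')) ` p"
    then have "\<phi> ` q = (\<lambda>(x, y). (a * d * x + (a * t' + s), b * c * y + (b * s' + t))) ` p"
      by (simp add: image_image case_prod_beta algebra_simps)
    then show ?thesis unfolding is_copy_iff using signs by blast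
  qed
qed

lemma tiles_motion:
  assumes "tiles p \<Omega>" and ab: "a = 1 \<or> a = - 1" "b = 1 \<or> b = - 1"
    and \<phi>: "\<phi> = (\<lambda>(x, y). (a * x + s, b * y + t)) \<or> \<phi> = (\<lambda>(x, y). (a * y + s, b * x + t))"
  shows "tiles p (\<phi> ` \<Omega>)"
proof -
  obtain T where T: "is_tiling p \<Omega> T" using assms(1) by (auto simp: tiles_def)
  have "inj \<phi>" using \<phi> ab by (elim disjE) (auto intro!: injI)
  have "pairwise disjnt ((`) \<phi> ` T)"
  proof (rule pairwise_imageI)
    fix q q' assume "q \<in> T" "q' \<in> T" "q \<noteq> q'"
    then have "disjnt q q'" using T by (auto simp: is_tiling_def pairwise_def)
    then show "disjnt (\<phi> ` q) (\<phi> ` q')"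
      using image_Int[OF \<open>inj \<phi>\<close>, of q q'] by (simp add: disjnt_def)
  qed
  moreover have "is_copy p q \<and> q \<subseteq> \<phi> ` \<Omega>" if "q \<in> (`) \<phi> ` T" for q
    using that T is_copy_motion[OF _ ab \<phi>] by (auto simp: is_tiling_def)
  moreover have "\<Union> ((`) \<phi> ` T) = \<phi> ` \<Omega>" using T by (auto simp: is_tiling_def)
  ultimately have "is_tiling p (\<phi> ` \<Omega>) ((`) \<phi> ` T)"
    unfolding is_tiling_def by simp
  then show ?thesis unfolding tiles_def by blast
qed

lemma tiles_UN:
  assumes tiles: "\<And>i. i \<in> I \<Longrightarrow> tiles p (\<Omega> i)"
    and disj: "\<And>i j. i \<in> I \<Longrightarrow> j \<in> I \<Longrightarrow> i \<noteq> j \<Longrightarrow> \<Omega> i \<inter> \<Omega> j = {}"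
  shows "tiles p (\<Union>i\<in>I. \<Omega> i)"
proof -
  obtain T where T: "\<And>i. i \<in> I \<Longrightarrow> is_tiling p (\<Omega> i) (T i)"
    using tiles unfolding tiles_def by metis
  have "pairwise disjnt (\<Union>i\<in>I. T i)"
  proof (rule pairwiseI)
    fix q q' assume "q \<in> (\<Union>i\<in>I. T i)" "q' \<in> (\<Union>i\<in>I. T i)" and ne: "q \<noteq> q'"
    then obtain i j where i: "i \<in> I" "q \<in> T i" and j: "j \<in> I" "q' \<in> T j" by blast
    show "disjnt q q'"
    proof (cases "i = j")
      case True
      then show ?thesis using T[OF i(1)] i j ne by (auto simp: is_tiling_def pairwise_def)
    next
      case False
      moreover have "q \<subseteq> \<Omega> i" "q' \<subseteq> \<Omega> j" using T i j by (auto simp: is_tiling_def)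
      ultimately show ?thesis using disj[OF i(1) j(1)] by (auto simp: disjnt_def)
    qed
  qed
  moreover have "\<forall>q \<in> (\<Union>i\<in>I. T i). is_copy p q \<and> q \<subseteq> (\<Union>i\<in>I. \<Omega> i)"
    using T unfolding is_tiling_def by blast
  moreover have "\<Union> (\<Union>i\<in>I. T i) = (\<Union>i\<in>I. \<Union> (T i))" by blast
  then have "\<Union> (\<Union>i\<in>I. T i) = (\<Union>i\<in>I. \<Omega> i)"
    using T by (simp add: is_tiling_def)
  ultimately have "is_tiling p (\<Union>i\<in>I. \<Omega> i) (\<Union>i\<in>I. T i)"
    by (simp add: is_tiling_def)
  then show ?thesis unfolding tiles_def by blast
qed

lemma tiles_Un:
  assumes "tiles p A" "tiles p B" "A \<inter> B = {}"
  shows "tiles p (A \<union> B)"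
  using tiles_UN[of UNIV p "\<lambda>i. if i then A else B"] assms
  by (auto simp: UNIV_bool Un_commute Int_commute split: if_splits)

text \<open>\<open>disj\<close> asks that a cell determine its translate; for periodic families the
  index is a quotient by the period.\<close>

lemma tiles_translates:
  fixes s t :: "'i \<Rightarrow> int"
  assumes U: "tiles p U"
    and disj: "\<And>i j x y. i \<in> I \<Longrightarrow> j \<in> I \<Longrightarrow> (x - s i, y - t i) \<in> U \<Longrightarrow> (x - s j, y - t j) \<in> U \<Longrightarrow> i = j"
  shows "tiles p {(x, y). \<exists>i \<in> I. (x - s i, y - t i) \<in> U}"
proof -
  define \<Omega> where "\<Omega> i = (\<lambda>(x, y). (1 * x + s i, 1 * y + t i)) ` U" for i
  have mem: "(x, y) \<in> \<Omega> i \<longleftrightarrow> (x - s i, y - t i) \<in> U" for x y i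
    unfolding \<Omega>_def using mem_motion(1)[of 1 1 x y "s i" "t i" U] by simp
  have "tiles p (\<Union>i\<in>I. \<Omega> i)"
  proof (rule tiles_UN)
    show "tiles p (\<Omega> i)" for i
      unfolding \<Omega>_def by (rule tiles_motion[OF U, of 1 1 _ "s i" "t i"]) auto
    show "\<Omega> i \<inter> \<Omega> j = {}" if "i \<in> I" "j \<in> I" "i \<noteq> j" for i j
      using disj[OF that(1,2)] that(3) mem by auto
  qed
  also have "(\<Union>i\<in>I. \<Omega> i) = {(x, y). \<exists>i \<in> I. (x - s i, y - t i) \<in> U}"
    using mem by auto
  finally show ?thesis .
qed

section \<open>Capabilities that follow from a rectangle\<close>

lemma div_eq_iff_mem: "(u::int) > 0 \<Longrightarrow> x div u = i \<longleftrightarrow> x - u * i \<in> {0..u - 1}"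
  by (smt (verit) atLeastAtMost_iff div_pos_pos_trivial minus_mult_div_eq_mod mod_pos_pos_trivial
      nonzero_mult_div_cancel_left pos_mod_bound pos_mod_sign div_mult_self2 diff_add_cancel)

text \<open>\<open>2 * u * v\<close> is a multiple of both sides, so aligned squares of this side
  split into aligned rectangles. The factor 2 makes the side at least 2, as an enlargement
  requires.\<close>

lemma tiles_squares:
  assumes rect: "tiles p ({0..u - 1} \<times> {0..v - 1})" and uv: "u \<ge> 1" "v \<ge> 1"
  shows "tiles p {(x, y). (x div (2 * u * v), y div (2 * u * v)) \<in> S}"
proof -
  \<comment> \<open>Each square is \<open>2 * v\<close> rectangles wide and \<open>2 * u\<close>
    rectangles high.\<close>
  define R where "R = {(i, j). (i div (2 * v), j div (2 * u)) \<in> S}"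
  have mem: "(x - u * fst i, y - v * snd i) \<in> {0..u - 1} \<times> {0..v - 1} \<longleftrightarrow> (x div u, y div v) = i" for x y i
    using div_eq_iff_mem[of u x "fst i"] div_eq_iff_mem[of v y "snd i"] uv by (cases i) auto
  have "tiles p {(x, y). \<exists>i \<in> R. (x - u * fst i, y - v * snd i) \<in> {0..u - 1} \<times> {0..v - 1}}"
    by (rule tiles_translates[OF rect]) (simp only: mem)
  also have "{(x, y). \<exists>i \<in> R. (x - u * fst i, y - v * snd i) \<in> {0..u - 1} \<times> {0..v - 1}} =
      {(x, y). (x div u, y div v) \<in> R}"
    by (simp only: mem) auto
  also have "\<dots> = {(x, y). (x div (2 * u * v), y div (2 * u * v)) \<in> S}"
    using zdiv_zmult2_eq[of "2 * v" _ u] zdiv_zmult2_eq[of "2 * u" _ v] uv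
    by (simp add: R_def mult_ac)
  finally show ?thesis .
qed

lemma enlargement_eq:
  assumes "k \<ge> 1"
  shows "enlargement k p = {(x, y). (x div k, y div k) \<in> p}"
proof -
  have "k * i \<le> x \<and> x \<le> k * i + k - 1 \<longleftrightarrow> x div k = i" for x i
    using div_eq_iff_mem[of k x i] assms by auto
  then show ?thesis
    by (auto simp: enlargement_def)
qed

text \<open>For suitable dimensions every region in question is a union of aligned squares of side
  \<open>N\<close>. Only the index set \<open>S\<close> changes; the enlargement by the factor
  \<open>N\<close> is the case \<open>S = p\<close>.\<close>

lemma tiles_rectangle_imp_rectangle_profile:
  assumes "tiles_rectangle p"
  shows "rectangle_profile p"
proof -
  obtain u v where uv: "u \<ge> 1" "v \<ge> 1" and rect: "tiles p ({0..u - 1} \<times> {0..v - 1})"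
    using assms by (auto simp: tiles_rectangle_def)
  define N where "N = 2 * u * v"
  have "1 \<le> u * v" using mult_mono[of 1 u 1 v] uv by simp
  then have N: "N \<ge> 2" by (simp add: N_def)
  have squares: "tiles p {(x, y). (x div N, y div N) \<in> S}" for S
    unfolding N_def by (rule tiles_squares[OF rect uv])
  have ge: "0 \<le> x div N \<longleftrightarrow> 0 \<le> x" for x
    using N by (simp add: pos_imp_zdiv_nonneg_iff)
  have eq: "x div N = 0 \<longleftrightarrow> 0 \<le> x \<and> x < N" for x
    using div_eq_iff_mem[of N x 0] N by auto
  have "tiles_half_strip p"
    unfolding tiles_half_strip_def
    by (intro exI[of _ N] conjI back_subst[of "tiles p", OF squares[of "{0..} \<times> {0}"]])
      (use N in \<open>auto simp: ge eq\<close>)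
  moreover have "tiles_bent_strip p"
    unfolding tiles_bent_strip_def
    by (intro exI[of _ N] conjI back_subst[of "tiles p", OF squares[of "{(i, j). 0 \<le> i \<and> 0 \<le> j \<and> (i = 0 \<or> j = 0)}"]])
      (use N in \<open>auto simp: ge eq\<close>)
  moreover have "tiles_quadrant p"
    unfolding tiles_quadrant_def
    by (rule back_subst[of "tiles p", OF squares[of "{0..} \<times> {0..}"]]) (auto simp: ge)
  moreover have "tiles_strip p"
    unfolding tiles_strip_def
    by (intro exI[of _ N] conjI back_subst[of "tiles p", OF squares[of "UNIV \<times> {0}"]]) (use N in \<open>auto simp: eq\<close>)
  moreover have "tiles_half_plane p"
    unfolding tiles_half_plane_def
    by (rule back_subst[of "tiles p", OF squares[of "UNIV \<times> {0..}"]]) (auto simp: ge)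
  moreover have "tiles_plane p"
    unfolding tiles_plane_def
    by (rule back_subst[of "tiles p", OF squares[of UNIV]]) auto
  moreover have "tiles_enlargement p"
    unfolding tiles_enlargement_def
    by (intro exI[of _ N]) (use N squares[of p] enlargement_eq[of N p] in auto)
  ultimately show ?thesis
    using assms by (simp add: rectangle_profile_def)
qed

section \<open>Copies as bars with a bump\<close>

text \<open>Naming a copy by the least cell of its bar, the offset \<open>e\<close> of the bump
  along the bar and its side \<open>d\<close> turns questions about copies into linear
  arithmetic.\<close>

definition hpiece :: "int \<Rightarrow> int \<Rightarrow> int \<Rightarrow> int \<Rightarrow> int \<Rightarrow> cell set" where
  "hpiece L x y e d = insert (x + e, y + d) ({x..<x + L} \<times> {y})"

definition vpiece :: "int \<Rightarrow> int \<Rightarrow> int \<Rightarrow> int \<Rightarrow> int \<Rightarrow> cell set" where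
  "vpiece L x y e d = insert (x + d, y + e) ({x} \<times> {y..<y + L})"

lemma mem_hpiece: "(u, v) \<in> hpiece L x y e d \<longleftrightarrow> x \<le> u \<and> u < x + L \<and> v = y \<or> u = x + e \<and> v = y + d"
  by (auto simp: hpiece_def)

lemma mem_vpiece: "(u, v) \<in> vpiece L x y e d \<longleftrightarrow> u = x \<and> y \<le> v \<and> v < y + L \<or> u = x + d \<and> v = y + e"
  by (auto simp: vpiece_def)

lemma cross_eq_hpiece: "cross n 1 1 0 = hpiece (int n + 2) (- 1) 0 1 1"
  by (auto simp: cross_def mem_hpiece)

text \<open>Reversing a bar makes its last cell the first, which accounts for the shift by
  \<open>L - 1\<close> and the offset \<open>L - 1 - e\<close>.\<close>

lemma motion_hpiece:
  "(\<lambda>(x, y). (1 * x + s, b * y + t)) ` hpiece L x0 y0 e d = hpiece L (x0 + s) (b * y0 + t) e (b * d)"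
  "(\<lambda>(x, y). (- 1 * x + s, b * y + t)) ` hpiece L x0 y0 e d =
     hpiece L (s - x0 - L + 1) (b * y0 + t) (L - 1 - e) (b * d)"
  "(\<lambda>(x, y). (a * y + s, 1 * x + t)) ` hpiece L x0 y0 e d = vpiece L (a * y0 + s) (x0 + t) e (a * d)"
  "(\<lambda>(x, y). (a * y + s, - 1 * x + t)) ` hpiece L x0 y0 e d =
     vpiece L (a * y0 + s) (t - x0 - L + 1) (L - 1 - e) (a * d)"
proof -
  have ivl: "{u<..v} = {1 + u..<1 + v}" for u v :: int by auto
  have h: "(\<lambda>(x, y). (c * x + s, b * y + t)) ` (A \<times> {y0}) = ((\<lambda>x. c * x + s) ` A) \<times> {b * y0 + t}"
    and v: "(\<lambda>(x, y). (b * y + s, c * x + t)) ` (A \<times> {y0}) = {b * y0 + s} \<times> ((\<lambda>x. c * x + t) ` A)"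
    for A :: "int set" and b c s t :: int
    by (auto simp: image_iff)
  show "(\<lambda>(x, y). (1 * x + s, b * y + t)) ` hpiece L x0 y0 e d = hpiece L (x0 + s) (b * y0 + t) e (b * d)"
    unfolding hpiece_def image_insert h by (simp add: algebra_simps)
  show "(\<lambda>(x, y). (- 1 * x + s, b * y + t)) ` hpiece L x0 y0 e d =
     hpiece L (s - x0 - L + 1) (b * y0 + t) (L - 1 - e) (b * d)"
    unfolding hpiece_def image_insert h by (simp add: ivl algebra_simps)
  show "(\<lambda>(x, y). (a * y + s, 1 * x + t)) ` hpiece L x0 y0 e d = vpiece L (a * y0 + s) (x0 + t) e (a * d)"
    unfolding hpiece_def vpiece_def image_insert v by (simp add: algebra_simps)
  show "(\<lambda>(x, y). (a * y + s, - 1 * x + t)) ` hpiece L x0 y0 e d =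
     vpiece L (a * y0 + s) (t - x0 - L + 1) (L - 1 - e) (a * d)"
    unfolding hpiece_def vpiece_def image_insert v by (simp add: ivl algebra_simps)
qed

text \<open>The eight symmetries correspond to two directions of the bar, two ends near which the
  bump may sit and two sides of the bar.\<close>

lemma is_copy_cross_iff:
  assumes L: "L = int n + 2"
  shows "is_copy (cross n 1 1 0) q \<longleftrightarrow> (\<exists>x y e d. (e = 1 \<or> e = L - 2) \<and> (d = 1 \<or> d = - 1) \<and>
      (q = hpiece L x y e d \<or> q = vpiece L x y e d))"
  (is "?C \<longleftrightarrow> ?R")
proof
  assume ?C
  then obtain a b s t where ab: "a = 1 \<or> a = - 1" "b = 1 \<or> b = - 1" and
    q: "q = (\<lambda>(x, y). (a * x + s, b * y + t)) ` hpiece L (- 1) 0 1 1 \<or>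
        q = (\<lambda>(x, y). (a * y + s, b * x + t)) ` hpiece L (- 1) 0 1 1"
    unfolding is_copy_iff cross_eq_hpiece L by blast
  from q show ?R
  proof
    assume q: "q = (\<lambda>(x, y). (a * x + s, b * y + t)) ` hpiece L (- 1) 0 1 1"
    have "q = hpiece L (- 1 + s) (b * 0 + t) 1 (b * 1) \<or> q = hpiece L (s - - 1 - L + 1) (b * 0 + t) (L - 1 - 1) (b * 1)"
      using ab(1) by (elim disjE) (simp_all only: q motion_hpiece simp_thms)
    moreover have "L - 1 - 1 = L - 2" by simp
    ultimately show ?R using ab(2) by (metis mult_1_right)
  next
    assume q: "q = (\<lambda>(x, y). (a * y + s, b * x + t)) ` hpiece L (- 1) 0 1 1"
    have "q = vpiece L (a * 0 + s) (- 1 + t) 1 (a * 1) \<or> q = vpiece L (a * 0 + s) (t - - 1 - L + 1) (L - 1 - 1) (a * 1)"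
      using ab(2) by (elim disjE) (simp_all only: q motion_hpiece simp_thms)
    moreover have "L - 1 - 1 = L - 2" by simp
    ultimately show ?R using ab(1) by (metis mult_1_right)
  qed
next
  assume ?R
  then obtain x y e d where e: "e = 1 \<or> e = L - 2" and d: "d = 1 \<or> d = - 1"
    and q: "q = hpiece L x y e d \<or> q = vpiece L x y e d" by blast
  have "q = (\<lambda>(x', y'). (1 * x' + (x + 1), d * y' + y)) ` hpiece L (- 1) 0 1 1 \<or>
      q = (\<lambda>(x', y'). (- 1 * x' + (x + L - 2), d * y' + y)) ` hpiece L (- 1) 0 1 1 \<or>
      q = (\<lambda>(x', y'). (d * y' + x, 1 * x' + (y + 1))) ` hpiece L (- 1) 0 1 1 \<or>
      q = (\<lambda>(x', y'). (d * y' + x, - 1 * x' + (y + L - 2))) ` hpiece L (- 1) 0 1 1"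
    unfolding motion_hpiece using q e by (elim disjE) simp_all
  then show ?C
    unfolding is_copy_iff cross_eq_hpiece L[symmetric] using d by blast
qed

section \<open>Bent strips\<close>

text \<open>The two copies are half-turn images of each other; each bump fills the cell just beyond
  an end of the other bar.\<close>

lemma tiles_staggered_pair:
  "tiles (cross n 1 1 0) {(x, y). y = 0 \<and> 0 \<le> x \<and> x \<le> int n + 2 \<or> y = 1 \<and> 1 \<le> x \<and> x \<le> int n + 3}"
proof -
  define L where "L = int n + 2"
  have L: "L \<ge> 2" by (simp add: L_def)
  have "is_copy (cross n 1 1 0) (hpiece L 0 0 1 1)" "is_copy (cross n 1 1 0) (hpiece L 2 1 (L - 2) (- 1))"
    unfolding is_copy_cross_iff[OF L_def] by blast+
  moreover have "disjnt (hpiece L 0 0 1 1) (hpiece L 2 1 (L - 2) (- 1))"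
    using L by (auto simp: disjnt_iff mem_hpiece)
  moreover have "hpiece L 0 0 1 1 \<union> hpiece L 2 1 (L - 2) (- 1) =
      {(x, y). y = 0 \<and> 0 \<le> x \<and> x \<le> int n + 2 \<or> y = 1 \<and> 1 \<le> x \<and> x \<le> int n + 3}"
    unfolding set_eq_iff split_paired_All Un_iff mem_hpiece by (auto simp: L_def)
  ultimately have "is_tiling (cross n 1 1 0)
      {(x, y). y = 0 \<and> 0 \<le> x \<and> x \<le> int n + 2 \<or> y = 1 \<and> 1 \<le> x \<and> x \<le> int n + 3}
      {hpiece L 0 0 1 1, hpiece L 2 1 (L - 2) (- 1)}"
    by (auto simp: is_tiling_def pairwise_insert disjnt_sym)
  then show ?thesis by (auto simp: tiles_def)
qed

text \<open>The period \<open>n + 3\<close> is the number of cells of a pair in each row. For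
  \<open>I = {0..}\<close> the upper row starts one cell later, leaving the cell
  \<open>(0, 1)\<close> free for the bend.\<close>

lemma tiles_staggered_strip:
  assumes "I = {0..} \<or> I = (UNIV :: int set)"
  shows "tiles (cross n 1 1 0) {(x, y). y = 0 \<and> x \<in> I \<or> y = 1 \<and> x - 1 \<in> I}"
proof -
  define k where "k = int n + 3"
  have k: "k > 0" by (simp add: k_def)
  have mem: "(x - k * i, y - 0) \<in> {(x, y). y = 0 \<and> 0 \<le> x \<and> x \<le> int n + 2 \<or> y = 1 \<and> 1 \<le> x \<and> x \<le> int n + 3}
      \<longleftrightarrow> y = 0 \<and> x div k = i \<or> y = 1 \<and> (x - 1) div k = i" for x y i :: int
    using div_eq_iff_mem[OF k, of x i] div_eq_iff_mem[OF k, of "x - 1" i] by (auto simp: k_def)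
  have "tiles (cross n 1 1 0) {(x, y). \<exists>i\<in>I. (x - k * i, y - 0) \<in>
      {(x, y). y = 0 \<and> 0 \<le> x \<and> x \<le> int n + 2 \<or> y = 1 \<and> 1 \<le> x \<and> x \<le> int n + 3}}"
    by (rule tiles_translates[OF tiles_staggered_pair]) (unfold mem, auto)
  also have "\<dots> = {(x, y). y = 0 \<and> x div k \<in> I \<or> y = 1 \<and> (x - 1) div k \<in> I}"
    unfolding mem by auto
  also have "\<dots> = {(x, y). y = 0 \<and> x \<in> I \<or> y = 1 \<and> x - 1 \<in> I}"
    using assms pos_imp_zdiv_nonneg_iff[OF k] by auto
  finally show ?thesis .
qed

text \<open>The second arm \<open>?B\<close> is the mirror image of \<open>?A\<close> in the
  diagonal, moved up by one, and starts at the cell \<open>(0, 1)\<close> that \<open>?A\<close>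
  leaves free.\<close>

lemma tiles_bent_strip_2:
  "tiles (cross n 1 1 0) {(x, y). 0 \<le> x \<and> 0 \<le> y \<and> (x < 2 \<or> y < 2)}"
proof -
  let ?A = "{(x, y). y = 0 \<and> x \<in> {0..} \<or> y = 1 \<and> x - 1 \<in> {0::int..}} :: cell set"
  let ?B = "(\<lambda>(x, y). (1 * y + 0, 1 * x + 1)) ` ?A"
  have A: "tiles (cross n 1 1 0) ?A" by (rule tiles_staggered_strip) simp
  have B: "tiles (cross n 1 1 0) ?B" by (rule tiles_motion[OF A, of 1 1 _ 0 1]) auto
  have memB: "(x, y) \<in> ?B \<longleftrightarrow> x = 0 \<and> 1 \<le> y \<or> x = 1 \<and> 2 \<le> y" for x y
    by (subst mem_motion) auto
  have "?A \<inter> ?B = {}" using memB by auto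
  with A B have "tiles (cross n 1 1 0) (?A \<union> ?B)" by (rule tiles_Un)
  also have "?A \<union> ?B = {(x, y). 0 \<le> x \<and> 0 \<le> y \<and> (x < 2 \<or> y < 2)}"
    using memB by auto
  finally show ?thesis .
qed

lemma cross_bent_strip_capabilities:
  fixes n :: nat
  defines "p \<equiv> cross n 1 1 0"
  shows "tiles_bent_strip p" "tiles_quadrant p" "tiles_strip p" "tiles_half_plane p" "tiles_plane p"
proof -
  show "tiles_bent_strip p"
    unfolding tiles_bent_strip_def p_def by (intro exI[of _ 2]) (use tiles_bent_strip_2 in simp)
  \<comment> \<open>Bent strips of width 2, nested along the diagonal, fill the quadrant.\<close>
  have "tiles p {(x, y). \<exists>i \<in> {0::int..}. (x - 2 * i, y - 2 * i) \<in> {(x, y). 0 \<le> x \<and> 0 \<le> y \<and> (x < 2 \<or> y < 2)}}"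
    unfolding p_def by (rule tiles_translates[OF tiles_bent_strip_2]) auto
  also have "\<dots> = {0..} \<times> {0..}"
  proof -
    have "\<exists>i\<ge>0. 2 * i \<le> x \<and> 2 * i \<le> y \<and> (x - 2 * i < 2 \<or> y - 2 * i < 2)" if "0 \<le> x" "0 \<le> y" for x y :: int
      using that by (intro exI[of _ "min x y div 2"]) auto
    then show ?thesis by fastforce
  qed
  finally show "tiles_quadrant p" by (simp add: tiles_quadrant_def)
  have "{(x :: int, y :: int). y = 0 \<and> x \<in> UNIV \<or> y = 1 \<and> x - 1 \<in> UNIV} = UNIV \<times> {0..2 - 1}"
    by auto
  then have strip: "tiles p (UNIV \<times> {0..2 - 1})"
    using tiles_staggered_strip[of UNIV n] by (simp add: p_def)
  then show "tiles_strip p" unfolding tiles_strip_def by (intro exI[of _ 2]) simp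
  have mem: "(x - 0, y - 2 * i) \<in> UNIV \<times> {0..2 - 1} \<longleftrightarrow> y div 2 = i" for x y i :: int
    by auto
  have stack: "tiles p {(x, y). y div 2 \<in> I}" for I :: "int set"
  proof -
    have "tiles p {(x, y). \<exists>i \<in> I. (x - 0, y - 2 * i) \<in> UNIV \<times> {0..2 - 1}}"
      by (rule tiles_translates[OF strip]) (unfold mem, simp)
    then show ?thesis unfolding mem by simp
  qed
  have "{(x :: int, y :: int). y div 2 \<in> {0..}} = UNIV \<times> {0..}" by auto
  then show "tiles_half_plane p" using stack[of "{0..}"] by (simp add: tiles_half_plane_def)
  show "tiles_plane p" using stack[of UNIV] by (simp add: tiles_plane_def)
qed

section \<open>No half-strip for bars of length at least six\<close>

text \<open>Only the rows below \<open>h\<close> of the region are prescribed; above them it is arbitrary, so that the region may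
  be an enlarged polyomino with one arm pointing downwards.\<close>

locale arm =
  fixes T :: "cell set set" and \<Omega> :: "cell set" and L w h :: int
  assumes shape: "q \<in> T \<Longrightarrow> \<exists>x y e d. (e = 1 \<or> e = L - 2) \<and> (d = 1 \<or> d = - 1) \<and>
      (q = hpiece L x y e d \<or> q = vpiece L x y e d)"
    and inside: "q \<in> T \<Longrightarrow> q \<subseteq> \<Omega>"
    and overlap: "q \<in> T \<Longrightarrow> q' \<in> T \<Longrightarrow> c \<in> q \<Longrightarrow> c \<in> q' \<Longrightarrow> q = q'"
    and cover: "c \<in> \<Omega> \<Longrightarrow> \<exists>q \<in> T. c \<in> q"
    and region: "y < h \<Longrightarrow> (x, y) \<in> \<Omega> \<longleftrightarrow> 0 \<le> x \<and> x < w \<and> 0 \<le> y"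
    and L: "6 \<le> L" and w: "1 \<le> w" and h: "4 * w \<le> h" "L \<le> h"
begin

definition H :: "int \<Rightarrow> int \<Rightarrow> int \<Rightarrow> int \<Rightarrow> bool" where
  "H x y e d \<longleftrightarrow> (e = 1 \<or> e = L - 2) \<and> (d = 1 \<or> d = - 1) \<and> hpiece L x y e d \<in> T"

definition V :: "int \<Rightarrow> int \<Rightarrow> int \<Rightarrow> int \<Rightarrow> bool" where
  "V x y e d \<longleftrightarrow> (e = 1 \<or> e = L - 2) \<and> (d = 1 \<or> d = - 1) \<and> vpiece L x y e d \<in> T"

text \<open>Copies sharing a cell coincide, and the cell set determines the parameters: the two ends
  of one bar cannot both be the bump of the other description, so the rows agree, then the left ends
  and the bumps.\<close>

lemma H_H:
  assumes "H x y e d" "H x' y' e' d'" "c \<in> hpiece L x y e d" "c \<in> hpiece L x' y' e' d'"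
  shows "x' = x \<and> y' = y \<and> e' = e \<and> d' = d"
proof -
  have eq: "hpiece L x y e d = hpiece L x' y' e' d'"
    using assms overlap unfolding H_def by blast
  have iff: "\<And>u v. (x \<le> u \<and> u < x + L \<and> v = y \<or> u = x + e \<and> v = y + d) \<longleftrightarrow>
     (x' \<le> u \<and> u < x' + L \<and> v = y' \<or> u = x' + e' \<and> v = y' + d')"
    using eq mem_hpiece by metis
  have e: "1 \<le> e" "e \<le> L - 2" "1 \<le> e'" "e' \<le> L - 2" and d: "d = 1 \<or> d = -1" "d' = 1 \<or> d' = -1"
    using assms(1,2) L by (auto simp: H_def)
  have y: "y' = y"
    using iff[of x y] iff[of "x + L - 1" y] L e by (auto split: if_splits)
  have "x' = x"
    using iff[of x y] iff[of "x'" y] L e y d by auto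
  with y show ?thesis
    using iff[of "x + e" "y + d"] d by auto
qed

lemma V_V:
  assumes "V x y e d" "V x' y' e' d'" "c \<in> vpiece L x y e d" "c \<in> vpiece L x' y' e' d'"
  shows "x' = x \<and> y' = y \<and> e' = e \<and> d' = d"
proof -
  have eq: "vpiece L x y e d = vpiece L x' y' e' d'"
    using assms overlap unfolding V_def by blast
  have iff: "\<And>u v. (u = x \<and> y \<le> v \<and> v < y + L \<or> u = x + d \<and> v = y + e) \<longleftrightarrow>
     (u = x' \<and> y' \<le> v \<and> v < y' + L \<or> u = x' + d' \<and> v = y' + e')"
    using eq mem_vpiece by metis
  have e: "1 \<le> e" "e \<le> L - 2" "1 \<le> e'" "e' \<le> L - 2" and d: "d = 1 \<or> d = -1" "d' = 1 \<or> d' = -1"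
    using assms(1,2) L by (auto simp: V_def)
  have x: "x' = x"
    using iff[of x y] iff[of x "y + L - 1"] L e by (auto split: if_splits)
  have "y' = y"
    using iff[of x y] iff[of x "y'"] L e x d by auto
  with x show ?thesis
    using iff[of "x + d" "y + e"] d by auto
qed

text \<open>A row meets an upright copy in at most two cells, while a horizontal bar has three
  consecutive ones.\<close>

lemma H_V:
  assumes "H x y e d" "V x' y' e' d'" "c \<in> hpiece L x y e d"
  shows "c \<notin> vpiece L x' y' e' d'"
proof
  assume "c \<in> vpiece L x' y' e' d'"
  then have eq: "hpiece L x y e d = vpiece L x' y' e' d'"
    using assms overlap unfolding H_def V_def by blast
  have "(x, y) \<in> hpiece L x y e d" "(x + 1, y) \<in> hpiece L x y e d" "(x + 2, y) \<in> hpiece L x y e d"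
    using L by (auto simp: mem_hpiece)
  then show False
    unfolding eq using L assms(2) by (auto simp: mem_vpiece V_def)
qed

lemma H_inside:
  assumes "H x y e d" "y < h"
  shows "0 \<le> x" "x + L \<le> w" "0 \<le> y"
proof -
  have "(x, y) \<in> \<Omega>" "(x + L - 1, y) \<in> \<Omega>"
    using assms(1) inside L unfolding H_def by (auto simp: mem_hpiece subset_iff)
  then show "0 \<le> x" "x + L \<le> w" "0 \<le> y"
    using region assms(2) by auto
qed

lemma V_inside:
  assumes "V x y e d" "y \<le> v" "v < y + L" "v < h"
  shows "0 \<le> x" "x < w" "0 \<le> y"
proof -
  have "(x, y) \<in> \<Omega>"
    using assms(1) inside L unfolding V_def by (auto simp: mem_vpiece subset_iff)
  then show "0 \<le> x" "x < w" "0 \<le> y"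
    using region[of y x] assms by auto
qed

lemma cell_cases:
  assumes "(u, v) \<in> \<Omega>"
  obtains
    (hbar) x e d where "H x v e d" "x \<le> u" "u < x + L"
  | (vbar) y e d where "V u y e d" "y \<le> v" "v < y + L"
  | (hbump) x e d where "H x (v - d) e d" "u = x + e"
  | (vbump) y e d where "V (u - d) y e d" "v = y + e"
proof -
  obtain q where q: "q \<in> T" "(u, v) \<in> q"
    using cover assms by blast
  obtain x y e d where ed: "e = 1 \<or> e = L - 2" "d = 1 \<or> d = - 1"
      and *: "q = hpiece L x y e d \<or> q = vpiece L x y e d"
    using shape[OF q(1)] by blast
  from * show ?thesis
  proof
    assume q': "q = hpiece L x y e d"
    then have H: "H x y e d" using ed q by (simp add: H_def)
    from q(2)[unfolded q' mem_hpiece] show ?thesis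
    proof (elim disjE conjE)
      assume "u = x + e" "v = y + d"
      then show ?thesis using H hbump[of x d e] by simp
    qed (use H hbar in blast)
  next
    assume q': "q = vpiece L x y e d"
    then have V: "V x y e d" using ed q by (simp add: V_def)
    from q(2)[unfolded q' mem_vpiece] show ?thesis
    proof (elim disjE conjE)
      assume "u = x + d" "v = y + e"
      then show ?thesis using V vbump[of d y e] by simp
    qed (use V vbar in blast)
  qed
qed

section \<open>Horizontal bars in every row\<close>

text \<open>\<open>floor\<close> includes the diagonal neighbours below, because the bar behind a
  sideways bump passes through one of them. Without a horizontal bar only upright bars and downward
  bumps remain, and these collide.\<close>

lemma hbar_above:
  assumes cells: "\<And>u. x - 1 \<le> u \<Longrightarrow> u \<le> x + 1 \<Longrightarrow> (u, y) \<in> \<Omega>"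
    and floor: "\<And>u u' q. x - 1 \<le> u \<Longrightarrow> u \<le> x + 1 \<Longrightarrow> \<bar>u' - u\<bar> \<le> 1 \<Longrightarrow> q \<in> T \<Longrightarrow> (u, y) \<in> q \<Longrightarrow> (u', y - 1) \<notin> q"
  obtains u a e d where "x - 1 \<le> u" "u \<le> x + 1" "H a y e d" "a \<le> u" "u < a + L"
proof (rule ccontr)
  assume "\<not> thesis"
  then have no: "\<And>u a e d. x - 1 \<le> u \<Longrightarrow> u \<le> x + 1 \<Longrightarrow> H a y e d \<Longrightarrow> a \<le> u \<Longrightarrow> \<not> u < a + L"
    using that by blast
  have VD: "(\<exists>e d. V u y e d) \<or> (\<exists>a e. H a (y + 1) e (- 1) \<and> u = a + e)"
    if u: "x - 1 \<le> u" "u \<le> x + 1" for u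
    using cells[OF u]
  proof (cases rule: cell_cases)
    case (hbar x e d)
    then show ?thesis using no u by blast
  next
    case (vbar z e d)
    have "(u, y - 1) \<notin> vpiece L u z e d"
      using floor[OF u, of u "vpiece L u z e d"] vbar by (auto simp: V_def mem_vpiece)
    then have "z = y" using vbar by (auto simp: mem_vpiece)
    then show ?thesis using vbar by blast
  next
    case (hbump a e d)
    have e: "1 \<le> e" "e \<le> L - 2" and d: "d = 1 \<or> d = - 1"
      using hbump(1) L by (auto simp: H_def)
    have "d \<noteq> 1"
    proof
      assume "d = 1"
      then have "(u, y - 1) \<in> hpiece L a (y - d) e d" "(u, y) \<in> hpiece L a (y - d) e d"
        using hbump e by (auto simp: mem_hpiece)
      then show False
        using floor[OF u, of u "hpiece L a (y - d) e d"] hbump by (auto simp: H_def)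
    qed
    then show ?thesis using d hbump by auto
  next
    case (vbump z e d)
    have e: "1 \<le> e" "e \<le> L - 2" and d: "d = 1 \<or> d = - 1"
      using vbump(1) L by (auto simp: V_def)
    have "(u - d, y - 1) \<in> vpiece L (u - d) z e d" "(u, y) \<in> vpiece L (u - d) z e d"
      using vbump e by (auto simp: mem_vpiece)
    then show ?thesis
      using floor[OF u, of "u - d" "vpiece L (u - d) z e d"] vbump d by (auto simp: V_def)
  qed
  \<comment> \<open>A downward bump would cover the cells above its two neighbours.\<close>
  have noD: False
    if D: "H a (y + 1) e (- 1)" and u: "x - 1 \<le> a + e" "a + e \<le> x + 1"
      and u': "x - 1 \<le> u'" "u' \<le> x + 1" "\<bar>u' - (a + e)\<bar> = 1" for a e u'
  proof -
    have e: "1 \<le> e" "e \<le> L - 2"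
      using D L by (auto simp: H_def)
    have in1: "(u', y + 1) \<in> hpiece L a (y + 1) e (- 1)"
      using u' e by (auto simp: mem_hpiece)
    from VD[OF u'(1,2)] show False
    proof (elim disjE exE conjE)
      fix e' d assume "V u' y e' d"
      moreover have "(u', y + 1) \<in> vpiece L u' y e' d"
        using L by (auto simp: mem_vpiece)
      ultimately show False using H_V[OF D _ in1] by blast
    next
      fix a' e' assume D': "H a' (y + 1) e' (- 1)" and u'eq: "u' = a' + e'"
      have "1 \<le> e'" "e' \<le> L - 2" using D' L by (auto simp: H_def)
      then have "(u', y + 1) \<in> hpiece L a' (y + 1) e' (- 1)"
        using u'eq by (auto simp: mem_hpiece)
      then have "a' = a" "e' = e" using H_H[OF D D' in1] by auto
      then show False using u' u'eq by auto
    qed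
  qed
  have onlyV: "\<exists>e d. V u y e d" if u: "x - 1 \<le> u" "u \<le> x + 1" for u
  proof (cases "u \<le> x")
    case True
    then show ?thesis using VD[OF u] noD[where u' = "u + 1"] u by force
  next
    case False
    then show ?thesis using VD[OF u] noD[where u' = "u - 1"] u by force
  qed
  \<comment> \<open>The sideways bump of the middle bar meets the upright bar next to it, which
    starts in the same row and reaches above the bump.\<close>
  obtain e d where V: "V x y e d" using onlyV[of x] by auto
  have e: "1 \<le> e" "e \<le> L - 2" and d: "d = 1 \<or> d = - 1"
    using V L by (auto simp: V_def)
  obtain e' d' where V': "V (x + d) y e' d'" using onlyV[of "x + d"] d by auto
  have "(x + d, y + e) \<in> vpiece L x y e d" "(x + d, y + e) \<in> vpiece L (x + d) y e' d'"
    using e L by (auto simp: mem_vpiece)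
  then show False using V_V[OF V V'] d by auto
qed

text \<open>The given bar acts as the floor: a copy containing one of the three cells and a bar cell
  below it would be this copy itself, through its bump. The common column \<open>u\<close> links
  consecutive bars.\<close>

lemma hbar_next_row:
  assumes Ha: "H a y e d" and y: "0 \<le> y" "y + 1 < h"
  obtains u a' e' d' where "H a' (y + 1) e' d'" "a \<le> u" "u < a + L" "a' \<le> u" "u < a' + L"
proof -
  \<comment> \<open>Three cells that avoid both the bump and the ends of the bar, beside which an upright bar could stand.\<close>
  define x where "x = (if d = 1 \<and> e = 1 then a + 3 else a + 2)"
  have ed: "e = 1 \<or> e = L - 2" and T: "hpiece L a y e d \<in> T"
    using Ha by (auto simp: H_def)
  have x: "a + 2 \<le> x" "x \<le> a + 3" by (auto simp: x_def)
  have in\<Omega>: "0 \<le> a" "a + L \<le> w" using H_inside[OF Ha] y by auto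
  obtain u a' e' d' where *: "x - 1 \<le> u" "u \<le> x + 1" "H a' (y + 1) e' d'" "a' \<le> u" "u < a' + L"
  proof (rule hbar_above[of x "y + 1"])
    show "(u, y + 1) \<in> \<Omega>" if "x - 1 \<le> u" "u \<le> x + 1" for u
      using region y x L in\<Omega> that by auto
    show "(u', y + 1 - 1) \<notin> q"
      if u: "x - 1 \<le> u" "u \<le> x + 1" "\<bar>u' - u\<bar> \<le> 1" and q: "q \<in> T" "(u, y + 1) \<in> q" for u u' q
    proof
      assume "(u', y + 1 - 1) \<in> q"
      moreover have "(u', y) \<in> hpiece L a y e d"
        using u x L by (auto simp: mem_hpiece)
      ultimately have "q = hpiece L a y e d"
        using overlap[OF q(1) T] by simp
      then have "u = a + e" "d = 1" using q(2) by (auto simp: mem_hpiece)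
      then show False using u ed L by (auto simp: x_def split: if_splits)
    qed
  qed blast
  show ?thesis
    using that[OF *(3), of u] * x L by auto
qed

text \<open>From width 3 on, the border serves as the floor. In smaller widths no horizontal bar
  fits, so upright bars fill the bottom row, and the bump of the first one leaves the region or hits
  the second.\<close>

lemma floor_hbar: obtains a e d where "H a 0 e d"
proof (cases "3 \<le> w")
  case True
  have "(u', 0 - 1) \<notin> q" if "q \<in> T" for u' q
    using inside[OF that] region[of "- 1" u'] h L by auto
  moreover have "(u, 0) \<in> \<Omega>" if "1 - 1 \<le> u" "u \<le> 1 + 1" for u
    using region[of 0 u] h L True that by auto
  ultimately show ?thesis
    using hbar_above[of 1 0 thesis] that by blast
next
  case False
  have noH: "\<not> H x y e d" if "y < h" for x y e d
    using H_inside[of x y e d] that False L by force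
  have base: "\<exists>e d. V u 0 e d" if u: "0 \<le> u" "u < w" for u
  proof -
    have "(u, 0) \<in> \<Omega>" using region[of 0 u] h L u by auto
    then show ?thesis
    proof (cases rule: cell_cases)
      case (hbar x e d)
      then show ?thesis using noH h L by auto
    next
      case (vbar y e d)
      then have "y = 0" using V_inside[OF vbar(1), of y] h L by auto
      then show ?thesis using vbar by auto
    next
      case (hbump x e d)
      moreover have "0 - d < h" using hbump(1) h L by (auto simp: H_def)
      ultimately show ?thesis using noH by blast
    next
      case (vbump y e d)
      moreover have "1 \<le> e" using vbump(1) L by (auto simp: V_def)
      ultimately show ?thesis using V_inside[OF vbump(1), of y] h L by auto
    qed
  qed
  obtain e d where V0: "V 0 0 e d" using base[of 0] w by auto
  have e: "1 \<le> e" "e \<le> L - 2" and d: "d = 1 \<or> d = - 1"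
    using V0 L by (auto simp: V_def)
  have bump: "(d, e) \<in> vpiece L 0 0 e d" by (simp add: mem_vpiece)
  then have "(d, e) \<in> \<Omega>" using V0 inside by (auto simp: V_def)
  then have d1: "d = 1" "1 < w" using region[of e d] e h d by auto
  obtain e' d' where V1: "V 1 0 e' d'" using base[of 1] d1 by auto
  have "(d, e) \<in> vpiece L 1 0 e' d'" using d1 e by (simp add: mem_vpiece)
  then show ?thesis using V_V[OF V0 V1 bump] by auto
qed

text \<open>Consecutive bars share a column so that an upright bar cannot change sides of the chain.
  Nothing is demanded from row \<open>h\<close> on.\<close>

lemma hbar_chain:
  obtains B :: "nat \<Rightarrow> int" where
    "\<And>i. int i < h \<Longrightarrow> \<exists>e d. H (B i) (int i) e d"
    "\<And>i. int i + 1 < h \<Longrightarrow> \<exists>u. B i \<le> u \<and> u < B i + L \<and> B (Suc i) \<le> u \<and> u < B (Suc i) + L"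
proof -
  have "\<exists>B. \<forall>i. (int i < h \<longrightarrow> (\<exists>e d. H (B i) (int i) e d)) \<and>
      (int i + 1 < h \<longrightarrow> (\<exists>u. B i \<le> u \<and> u < B i + L \<and> B (Suc i) \<le> u \<and> u < B (Suc i) + L))"
  proof (rule dependent_nat_choice)
    show "\<exists>x. int 0 < h \<longrightarrow> (\<exists>e d. H x (int 0) e d)"
    proof -
      obtain a e d where "H a 0 e d" by (rule floor_hbar)
      then show ?thesis by auto
    qed
    show "\<exists>x'. (int (Suc i) < h \<longrightarrow> (\<exists>e d. H x' (int (Suc i)) e d)) \<and>
        (int i + 1 < h \<longrightarrow> (\<exists>u. x \<le> u \<and> u < x + L \<and> x' \<le> u \<and> u < x' + L))"
      if "int i < h \<longrightarrow> (\<exists>e d. H x (int i) e d)" for x i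
    proof (cases "int i + 1 < h")
      case True
      with that obtain e d where "H x (int i) e d" by auto
      then obtain u a' e' d' where "H a' (int i + 1) e' d'" "x \<le> u" "u < x + L" "a' \<le> u" "u < a' + L"
        by (rule hbar_next_row) (use True in auto)
      then show ?thesis by (metis of_nat_Suc add.commute)
    qed auto
  qed
  then show ?thesis using that by blast
qed

section \<open>Upright bars to the left of the chain\<close>

text \<open>The bump of the middle bar has to land on the bar above or below.\<close>

lemma no_three_stacked_hbars:
  assumes "H x y e d" "H x (y + 1) e' d'" "H x (y + 2) e'' d''"
  shows False
proof -
  have e: "1 \<le> e'" "e' \<le> L - 2" and d: "d' = 1 \<or> d' = - 1"
    using assms(2) L by (auto simp: H_def)
  have m: "(x + e', y + 1 + d') \<in> hpiece L x (y + 1) e' d'"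
    by (simp add: mem_hpiece)
  from d show False
  proof
    assume "d' = 1"
    then have "(x + e', y + 1 + d') \<in> hpiece L x (y + 2) e'' d''" using e by (simp add: mem_hpiece)
    then show False using H_H[OF assms(2,3) m] by auto
  next
    assume "d' = - 1"
    then have "(x + e', y + 1 + d') \<in> hpiece L x y e d" using e by (simp add: mem_hpiece)
    then show False using H_H[OF assms(2,1) m] by auto
  qed
qed

text \<open>The disjunct \<open>c = - 1\<close> lets the left border of the region play the role of the first upright bar.\<close>

definition wall :: "int \<Rightarrow> int \<Rightarrow> bool" where
  "wall c y \<longleftrightarrow> c = - 1 \<and> y = 0 \<or> (\<exists>e d. V c y e d)"

text \<open>The six rows lie on an upright bar because \<open>6 <= L\<close>; in the case of the
  border, column \<open>- 1\<close> is outside the region.\<close>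

lemma wall_blocks_hbar:
  assumes "wall c y" "H x v e d" "y \<le> v" "v < y + 6" "v < h"
  shows "c < x \<or> x + L \<le> c"
proof (rule ccontr)
  assume "\<not> ?thesis"
  then have m: "(c, v) \<in> hpiece L x v e d" by (auto simp: mem_hpiece)
  from assms(1) show False unfolding wall_def
  proof (elim disjE exE conjE)
    assume "c = - 1"
    then show False using m assms region[of v c] inside by (auto simp: H_def)
  next
    fix e' d' assume V: "V c y e' d'"
    have "(c, v) \<in> vpiece L c y e' d'" using assms L by (auto simp: mem_vpiece)
    then show False using H_V[OF assms(2) V m] by simp
  qed
qed

text \<open>Otherwise each of four rows next to the wall starts a horizontal bar or takes the bump
  of the wall. Column \<open>c + 2\<close> enters because an upright bar there may send its bump to
  the left.\<close>

lemma wall_neighbour: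
  assumes wall: "wall c y" and y: "0 \<le> y" "y + 5 < h" and c: "- 1 \<le> c" "c + 1 < w"
  obtains c' i y' e d where "c < c'" "c' \<le> c + 2" "1 \<le> i" "i \<le> 4" "V c' y' e d"
    "y' \<le> y + i" "y + i < y' + L"
proof (rule ccontr)
  note goal = that
  assume contr: "\<not> thesis"
  have no: "\<not> V c' y' e d"
    if "c < c'" "c' \<le> c + 2" "1 \<le> i" "i \<le> 4" "y' \<le> y + i" "y + i < y' + L" for c' i y' e d
    using contr goal that by blast
  have cases: "(\<exists>e d. H (c + 1) (y + i) e d) \<or> (\<exists>d. V c y i d)" if i: "1 \<le> i" "i \<le> 4" for i
  proof -
    \<comment> \<open>A horizontal copy whose bump lies in column \<open>c + 1\<close> has its bar
      in an adjacent row, across column \<open>c\<close>; hence six rows matter for four values of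
      \<open>i\<close>.\<close>
    have blocked: "\<not> (a \<le> c \<and> c < a + L)" if "H a v e d" "y \<le> v" "v \<le> y + 5" for a v e d
      using wall_blocks_hbar[OF wall that(1)] that y by auto
    have "(c + 1, y + i) \<in> \<Omega>" using region y c i by auto
    then show ?thesis
    proof (cases rule: cell_cases)
      case (hbar x e d)
      then have "x = c + 1" using blocked[OF hbar(1)] i by auto
      then show ?thesis using hbar by auto
    next
      case (vbar y' e d)
      then show ?thesis using no[of "c + 1" i y'] i by auto
    next
      case (hbump x e d)
      moreover have "1 \<le> e" "e \<le> L - 2" "d = 1 \<or> d = - 1" using hbump(1) L by (auto simp: H_def)
      ultimately show ?thesis using blocked[OF hbump(1)] i by auto
    next
      case (vbump y' e d)
      have e: "1 \<le> e" "e \<le> L - 2" and d: "d = 1 \<or> d = - 1" using vbump(1) L by (auto simp: V_def)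
      have "d \<noteq> - 1"
        using no[of "c + 2" i y' e d] i e vbump by (auto simp: add.commute)
      then have V: "V c y' e 1" using d vbump by auto
      \<comment> \<open>A bar in column \<open>c\<close> rules out the border, so the wall is an
        upright bar and coincides with this one.\<close>
      then have "0 \<le> c" using V_inside(1)[OF V, of "y + i"] vbump e i y by auto
      then obtain e' d' where V': "V c y e' d'" using wall by (auto simp: wall_def)
      have "(c, y + i) \<in> vpiece L c y' e 1" "(c, y + i) \<in> vpiece L c y e' d'"
        using vbump e i L by (auto simp: mem_vpiece)
      then have "y' = y" using V_V[OF V V'] by auto
      then show ?thesis using V vbump by auto
    qed
  qed
  have unique: "i = j" if "V c y i d" "V c y j d'" for i j d d'
    using V_V[OF that, of "(c, y)"] L by (auto simp: mem_vpiece)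
  have small: "i \<noteq> 2 \<and> i \<noteq> 3" if "V c y i d" for i d
    using that L by (auto simp: V_def)
  \<comment> \<open>As \<open>4 <= L - 2\<close>, the bump of the wall avoids offsets 2 and 3. It
    also misses offset 1 or 4, which supplies the third stacked bar.\<close>
  obtain e2 d2 e3 d3 where H2: "H (c + 1) (y + 2) e2 d2" and H3: "H (c + 1) (y + 3) e3 d3"
    using cases[of 2] cases[of 3] small[of 2] small[of 3] by force
  show False
  proof (cases "\<exists>d. V c y 1 d")
    case True
    then obtain e4 d4 where "H (c + 1) (y + 4) e4 d4"
      using cases[of 4] unique by force
    then show False using no_three_stacked_hbars[OF H2, of e3 d3 e4 d4] H3 by (simp add: add.assoc)
  next
    case False
    then obtain e1 d1 where "H (c + 1) (y + 1) e1 d1" using cases[of 1] by auto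
    then show False using no_three_stacked_hbars[of "c + 1" "y + 1" e1 d1 e2 d2 e3 d3] H2 H3 by (simp add: add.assoc)
  qed
qed

text \<open>The upright bars found on the way need not be higher up than the previous ones; only the column
  is sure to increase, while the bottom row increases by at most 4 in each step.\<close>

lemma contradiction: False
proof -
  obtain B :: "nat \<Rightarrow> int" where
    HB: "\<And>i. int i < h \<Longrightarrow> \<exists>e d. H (B i) (int i) e d" and
    linked: "\<And>i. int i + 1 < h \<Longrightarrow> \<exists>u. B i \<le> u \<and> u < B i + L \<and> B (Suc i) \<le> u \<and> u < B (Suc i) + L"
    using hbar_chain by blast
  have side: "c < B j \<or> B j + L \<le> c" if V: "V c y e d" and j: "y \<le> int j" "int j < y + L" "int j < h" for c y e d j
  proof (rule ccontr)
    assume neg: "\<not> ?thesis"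
    obtain e' d' where H': "H (B j) (int j) e' d'" using HB[OF j(3)] by blast
    have "(c, int j) \<in> hpiece L (B j) (int j) e' d'" "(c, int j) \<in> vpiece L c y e d"
      using neg j by (auto simp: mem_hpiece mem_vpiece)
    then show False using H_V[OF H' V] by blast
  qed
  \<comment> \<open>Changing sides would put chain bars of consecutive rows strictly on opposite
    sides of column \<open>c\<close>, although they share a column.\<close>
  have same_side: "c < B j \<longleftrightarrow> c < B k"
    if V: "V c y e d" and j: "y \<le> int j" "j \<le> k" "int k < y + L" "int k < h" for c y e d j k
    using j(2-4)
  proof (induction k rule: dec_induct)
    case (step m)
    then have "c < B j \<longleftrightarrow> c < B m" by simp
    moreover have "c < B m \<or> B m + L \<le> c" "c < B (Suc m) \<or> B (Suc m) + L \<le> c"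
      using side[OF V, of m] side[OF V, of "Suc m"] step j by auto
    moreover obtain u where "B m \<le> u \<and> u < B m + L \<and> B (Suc m) \<le> u \<and> u < B (Suc m) + L"
      using linked[of m] step by auto
    ultimately show ?case by linarith
  qed simp
  have bounds: "0 \<le> B i" "B i + L \<le> w" if "int i < h" for i
    using HB[OF that] H_inside that by blast+
  \<comment> \<open>The start is the border in column \<open>- 1\<close>; each step gains at least
    one column and raises the bottom row by at most 4.\<close>
  have "\<exists>c y. int m - 1 \<le> c \<and> 0 \<le> y \<and> y \<le> 4 * int m \<and> y < h \<and> wall c y \<and> c < B (nat y)" for m :: nat
  proof (induction m)
    case 0
    have "wall (- 1) 0" by (simp add: wall_def)
    moreover have "- 1 < B 0" using bounds(1)[of 0] h L by auto
    ultimately show ?case using h L by (intro exI[of _ "- 1"] exI[of _ 0]) auto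
  next
    case (Suc m)
    then obtain c y where c: "int m - 1 \<le> c" and y: "0 \<le> y" "y \<le> 4 * int m" "y < h"
      and wall: "wall c y" and right: "c < B (nat y)" by blast
    \<comment> \<open>A chain bar of at least six cells still fits to the right of column
      \<open>c\<close>; with \<open>4 * w <= h\<close> this keeps all rows in use below
      \<open>h\<close>.\<close>
    have m: "int m + 6 \<le> w" "c + 1 < w"
      using bounds(2)[of "nat y"] c y right L by auto
    then have rows: "y + 5 < h" using y h by auto
    obtain c' i y' e d where c': "c < c'" "c' \<le> c + 2" and i: "1 \<le> i" "i \<le> 4"
      and V: "V c' y' e d" and y': "y' \<le> y + i" "y + i < y' + L"
      using wall_neighbour[OF wall y(1) rows _ m(2)] c by (smt (verit) of_nat_0_le_iff)
    have y'0: "0 \<le> y'"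
      using V_inside(3)[OF V y'] i rows by auto
    have "c < B (nat (y + i))"
      using wall unfolding wall_def
    proof (elim disjE exE conjE)
      assume "c = - 1"
      then show ?thesis using bounds(1)[of "nat (y + i)"] y i rows by auto
    next
      fix e' d' assume "V c y e' d'"
      then show ?thesis
        using same_side[of c y e' d' "nat y" "nat (y + i)"] right y i rows L by auto
    qed
    moreover have "c' < B (nat (y + i)) \<or> B (nat (y + i)) + L \<le> c'"
      using side[OF V, of "nat (y + i)"] y' y i rows by auto
    \<comment> \<open>Two columns are too few to jump across a bar of length
      \<open>L\<close>.\<close>
    ultimately have "c' < B (nat (y + i))" using c' L by linarith
    \<comment> \<open>The comparison is carried down the new bar to its bottom row, where the next
      step starts.\<close>
    then have "c' < B (nat y')"
      using same_side[OF V, of "nat y'" "nat (y + i)"] y' y'0 i rows y by auto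
    moreover have "wall c' y'" using V by (auto simp: wall_def)
    ultimately show ?case
      using c c' y y' y'0 i rows by (intro exI[of _ c'] exI[of _ y']) auto
  qed
  from this[of "nat w"] obtain c y where
    "w - 1 \<le> c" "0 \<le> y" "y < h" "c < B (nat y)" using w by auto
  then show False using bounds(2)[of "nat y"] L by auto
qed

end

section \<open>Half-strips and enlargements\<close>

lemma arm_not_tileable:
  assumes n: "4 \<le> n" and w: "1 \<le> w" and h: "4 * w \<le> h" "int n + 2 \<le> h"
    and region: "\<And>x y. y < h \<Longrightarrow> (x, y) \<in> \<Omega> \<longleftrightarrow> 0 \<le> x \<and> x < w \<and> 0 \<le> y"
  shows "\<not> tiles (cross n 1 1 0) \<Omega>"
proof
  assume "tiles (cross n 1 1 0) \<Omega>"
  then obtain T where copies: "\<And>q. q \<in> T \<Longrightarrow> is_copy (cross n 1 1 0) q"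
    and sub: "\<And>q. q \<in> T \<Longrightarrow> q \<subseteq> \<Omega>" and disj: "pairwise disjnt T" and cover: "\<Union> T = \<Omega>"
    unfolding tiles_def is_tiling_def by blast
  interpret arm T \<Omega> "int n + 2" w h
  proof
    show "q = q'" if "q \<in> T" "q' \<in> T" "c \<in> q" "c \<in> q'" for q q' c
      using disj that unfolding pairwise_def disjnt_def by blast
  qed (use copies[unfolded is_copy_cross_iff[OF refl]] sub cover n w h region in auto)
  show False by (rule contradiction)
qed

text \<open>Swapping the coordinates makes the half-strip upright. Every row is prescribed, so
  \<open>h\<close> may be as large as needed.\<close>

lemma cross_not_half_strip:
  assumes n: "4 \<le> n"
  shows "\<not> tiles_half_strip (cross n 1 1 0)"
proof
  assume "tiles_half_strip (cross n 1 1 0)"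
  then obtain w where w: "w \<ge> 1" and half: "tiles (cross n 1 1 0) ({0..} \<times> {0..w - 1})"
    by (auto simp: tiles_half_strip_def)
  have "tiles (cross n 1 1 0) ((\<lambda>(x, y). (1 * y + 0, 1 * x + 0)) ` ({0..} \<times> {0..w - 1}))"
    by (rule tiles_motion[OF half, of 1 1 _ 0 0]) auto
  moreover have "\<not> tiles (cross n 1 1 0) ((\<lambda>(x, y). (1 * y + 0, 1 * x + 0)) ` ({0..} \<times> {0..w - 1}))"
    by (rule arm_not_tileable[OF n w, of "max (4 * w) (int n + 2)"], simp, simp, subst mem_motion) auto
  ultimately show False by simp
qed

text \<open>Beyond the central block the long arm has width \<open>k\<close> and length
  \<open>k * n\<close>, which is long enough because \<open>4 <= n\<close> and
  \<open>2 <= k\<close>.\<close>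

lemma cross_not_enlargement:
  assumes n: "4 \<le> n"
  shows "\<not> tiles_enlargement (cross n 1 1 0)"
proof
  assume "tiles_enlargement (cross n 1 1 0)"
  then obtain k where k: "k \<ge> 2" and tiles: "tiles (cross n 1 1 0) (enlargement k (cross n 1 1 0))"
    by (auto simp: tiles_enlargement_def)
  define m where "m = k * int n"
  have "4 * k \<le> int n * k" "2 * int n \<le> m"
    unfolding m_def by (rule mult_right_mono; use n k in simp)+
  then have m: "4 * k \<le> m" "int n + 2 \<le> m"
    using n by (simp add: m_def mult.commute, linarith)
  \<comment> \<open>A quarter turn points the long arm downwards; \<open>m + k - 1\<close> is the
    last column of the enlargement and becomes row 0.\<close>
  let ?\<Omega> = "(\<lambda>(x, y). (1 * y + 0, - 1 * x + (m + k - 1))) ` enlargement k (cross n 1 1 0)"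
  have "tiles (cross n 1 1 0) ?\<Omega>"
    by (rule tiles_motion[OF tiles, of 1 "- 1" _ 0 "m + k - 1"]) auto
  moreover have "\<not> tiles (cross n 1 1 0) ?\<Omega>"
  proof (rule arm_not_tileable[OF n _ m])
    show "1 \<le> k" using k by simp
    fix x y assume y: "y < m"
    \<comment> \<open>\<open>z\<close> is the original column of row \<open>y\<close>; rows below
      \<open>m\<close> come from columns beyond the central block.\<close>
    define z where "z = m + k - 1 - y"
    have z: "k \<le> z" using y by (simp add: z_def)
    have "1 \<le> z div k" using zdiv_mono1[OF z, of k] k by simp
    moreover have "z div k \<le> int n \<longleftrightarrow> z \<le> m + k - 1"
    proof -
      have "(z + (- (int n + 1)) * k) div k = - (int n + 1) + z div k"
        using k by (intro div_mult_self1) simp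
      then show ?thesis
        using pos_imp_zdiv_neg_iff[of k "z + (- (int n + 1)) * k"] k by (auto simp: m_def algebra_simps)
    qed
    moreover have "x div k = 0 \<longleftrightarrow> 0 \<le> x \<and> x < k"
      using div_eq_iff_mem[of k x 0] k by auto
    moreover have "(x, y) \<in> ?\<Omega> \<longleftrightarrow> (z div k, x div k) \<in> cross n 1 1 0"
      by (subst mem_motion) (use k enlargement_eq[of k "cross n 1 1 0"] in \<open>auto simp: z_def algebra_simps\<close>)
    ultimately show "(x, y) \<in> ?\<Omega> \<longleftrightarrow> 0 \<le> x \<and> x < k \<and> 0 \<le> y"
      by (auto simp: cross_def z_def)
  qed
  ultimately show False by simp
qed

text \<open>A tiled rectangle would give every capability, the half-strip included, so rectangles
  are excluded as well.\<close>

lemma cross_bent_strip_profile: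
  assumes "4 \<le> n"
  shows "bent_strip_profile (cross n 1 1 0)"
  using cross_bent_strip_capabilities[of n] cross_not_half_strip[OF assms] cross_not_enlargement[OF assms]
    tiles_rectangle_imp_rectangle_profile[of "cross n 1 1 0"]
  by (auto simp: bent_strip_profile_def rectangle_profile_def)

section \<open>Rectangles for short bars\<close>

text \<open>Lists instead of sets of cells allow a tiling to be checked by evaluation.\<close>

fun piece_cells :: "int \<Rightarrow> bool \<times> int \<times> int \<times> int \<times> int \<Rightarrow> cell list" where
  "piece_cells L (vertical, x, y, e, d) =
     (if vertical then (x + d, y + e) # map (\<lambda>i. (x, i)) [y..y + L - 1]
      else (x + e, y + d) # map (\<lambda>i. (i, y)) [x..x + L - 1])"

lemma set_piece_cells:
  "set (piece_cells L (vertical, x, y, e, d)) = (if vertical then vpiece L x y e d else hpiece L x y e d)"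
  by (auto simp: hpiece_def vpiece_def)

text \<open>Comparing sorted lists checks covering and disjointness at once.\<close>

lemma tiles_rectangle_by_list:
  assumes sorted: "sort (concat (map (piece_cells (int n + 2)) ps)) = List.product [0..u - 1] [0..v - 1]"
    and ed: "list_all (\<lambda>(vertical, x, y, e, d). (e = 1 \<or> e = int n) \<and> (d = 1 \<or> d = - 1)) ps"
    and uv: "u \<ge> 1" "v \<ge> 1"
  shows "tiles_rectangle (cross n 1 1 0)"
proof -
  let ?cells = "map (piece_cells (int n + 2)) ps"
  let ?T = "set ` set ?cells"
  have "distinct (concat ?cells)"
    using arg_cong[OF sorted, of distinct] by (simp add: distinct_product)
  then have disj: "set c \<inter> set c' = {}" if "c \<in> set ?cells" "c' \<in> set ?cells" "c \<noteq> c'" for c c'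
    using that unfolding distinct_concat_iff by blast
  have "\<Union> ?T = {0..u - 1} \<times> {0..v - 1}"
    using arg_cong[OF sorted, of set] by simp
  moreover have "pairwise disjnt ?T"
    unfolding pairwise_def disjnt_def using disj by blast
  moreover have "is_copy (cross n 1 1 0) q" if "q \<in> ?T" for q
  proof -
    obtain vertical x y e d where "(vertical, x, y, e, d) \<in> set ps"
      and q: "q = set (piece_cells (int n + 2) (vertical, x, y, e, d))"
      using \<open>q \<in> ?T\<close> by auto
    with ed have "e = 1 \<or> e = int n + 2 - 2" "d = 1 \<or> d = - 1"
      by (auto simp: list_all_iff)
    moreover have "q = hpiece (int n + 2) x y e d \<or> q = vpiece (int n + 2) x y e d"
      unfolding q set_piece_cells by simp
    ultimately show ?thesis
      unfolding is_copy_cross_iff[OF refl] by blast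
  qed
  ultimately have "is_tiling (cross n 1 1 0) ({0..u - 1} \<times> {0..v - 1}) ?T"
    unfolding is_tiling_def by blast
  then show ?thesis
    using uv unfolding tiles_rectangle_def tiles_def by blast
qed

text \<open>The L-tromino; here the offset \<open>L - 2\<close> is 0.\<close>

lemma tiles_rectangle_cross_0: "tiles_rectangle (cross 0 1 1 0)"
  by (rule tiles_rectangle_by_list[where u = 2 and v = 3 and ps = "[
     (False, 0, 0, 0, 1), (False, 0, 2, 1, - 1)]"]; code_simp)

text \<open>The T-tetromino: four copies form a pinwheel.\<close>

lemma tiles_rectangle_cross_1: "tiles_rectangle (cross 1 1 1 0)"
  by (rule tiles_rectangle_by_list[where u = 4 and v = 4 and ps = "[
     (True, 0, 0, 1, 1), (False, 0, 3, 1, - 1), (False, 1, 0, 1, 1), (True, 3, 1, 1, - 1)]"]; code_simp)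

text \<open>The Y-pentomino, with ten copies.\<close>

lemma tiles_rectangle_cross_2: "tiles_rectangle (cross 2 1 1 0)"
  by (rule tiles_rectangle_by_list[where u = 5 and v = 10 and ps = "[
     (True, 0, 0, 1, 1), (True, 1, 2, 2, - 1), (True, 0, 5, 1, 1), (False, 0, 9, 1, - 1),
     (False, 1, 0, 2, 1), (True, 2, 5, 2, - 1), (True, 2, 1, 1, 1), (True, 4, 1, 2, - 1),
     (True, 3, 4, 1, 1), (True, 4, 6, 2, - 1)]"]; code_simp)

text \<open>The 92 copies were found by a SAT solver. They are listed by their least cell, which keeps the
  insertion sort cheap.\<close>

lemma tiles_rectangle_cross_3: "tiles_rectangle (cross 3 1 1 0)"
  by (rule tiles_rectangle_by_list[where u = 23 and v = 24 and ps = "[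
     (False, 0, 0, 1, 1), (True, 0, 1, 1, 1), (True, 1, 5, 1, - 1), (True, 0, 7, 3, 1),
     (True, 1, 11, 1, - 1), (True, 0, 13, 3, 1), (True, 1, 17, 1, - 1), (True, 0, 19, 3, 1),
     (False, 1, 3, 1, - 1), (False, 1, 4, 1, 1), (False, 1, 23, 1, - 1), (False, 2, 1, 1, 1),
     (True, 2, 6, 1, 1), (True, 2, 11, 3, 1), (True, 3, 15, 1, - 1), (True, 2, 17, 3, 1),
     (False, 3, 5, 3, - 1), (False, 3, 6, 1, 1), (True, 3, 8, 1, 1), (True, 4, 10, 3, - 1),
     (False, 3, 21, 1, - 1), (False, 3, 22, 3, 1), (False, 4, 2, 3, - 1), (True, 5, 7, 1, - 1),
     (True, 4, 15, 3, 1), (False, 5, 0, 3, 1), (True, 5, 12, 1, 1), (True, 6, 14, 3, - 1),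
     (False, 5, 19, 3, - 1), (False, 5, 20, 3, 1), (False, 6, 3, 1, 1), (True, 6, 7, 1, 1),
     (True, 7, 9, 3, - 1), (True, 8, 6, 1, - 1), (True, 7, 14, 3, 1), (False, 7, 23, 1, - 1),
     (False, 8, 4, 3, - 1), (False, 8, 5, 1, 1), (True, 9, 8, 3, - 1), (True, 8, 12, 1, 1),
     (False, 9, 1, 1, - 1), (False, 9, 2, 3, 1), (True, 10, 6, 1, - 1), (True, 9, 14, 3, 1),
     (False, 9, 21, 1, - 1), (False, 9, 22, 3, 1), (True, 10, 11, 1, 1), (True, 11, 13, 3, - 1),
     (False, 10, 18, 3, - 1), (False, 10, 19, 1, 1), (False, 11, 0, 3, 1), (True, 11, 6, 1, 1),
     (True, 12, 8, 3, - 1), (True, 13, 5, 1, - 1), (True, 12, 13, 3, 1), (False, 12, 20, 3, - 1),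
     (False, 13, 3, 1, - 1), (False, 13, 4, 1, 1), (True, 14, 7, 3, - 1), (True, 13, 11, 1, 1),
     (False, 13, 23, 1, - 1), (True, 15, 5, 1, - 1), (True, 14, 13, 3, 1), (False, 14, 21, 1, 1),
     (False, 15, 1, 1, - 1), (False, 15, 2, 3, 1), (True, 15, 10, 1, 1), (True, 16, 12, 3, - 1),
     (False, 15, 17, 3, - 1), (False, 15, 18, 1, 1), (True, 16, 5, 1, 1), (True, 17, 7, 3, - 1),
     (False, 16, 22, 3, - 1), (False, 17, 0, 3, 1), (True, 18, 4, 1, - 1), (True, 17, 12, 3, 1),
     (False, 17, 19, 3, - 1), (False, 17, 20, 3, 1), (True, 18, 9, 1, 1), (True, 19, 11, 3, - 1),
     (False, 18, 23, 3, - 1), (True, 20, 2, 1, - 1), (True, 19, 4, 3, 1), (True, 20, 8, 1, - 1),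
     (True, 20, 13, 3, - 1), (True, 22, 0, 1, - 1), (True, 21, 2, 3, 1), (True, 22, 6, 1, - 1),
     (True, 21, 8, 3, 1), (True, 22, 12, 1, - 1), (True, 21, 14, 3, 1), (True, 22, 18, 3, - 1)]"]; code_simp)

theorem corollary2p2:
  fixes n :: nat
  shows "(n \<le> 3 \<longrightarrow> rectangle_profile (cross n 1 1 0)) \<and>
         (n \<ge> 4 \<longrightarrow> bent_strip_profile (cross n 1 1 0))"
proof (intro conjI impI)
  assume "n \<le> 3"
  then have "n \<in> {0, 1, 2, 3}" by auto
  then show "rectangle_profile (cross n 1 1 0)"
    using tiles_rectangle_imp_rectangle_profile tiles_rectangle_cross_0 tiles_rectangle_cross_1
      tiles_rectangle_cross_2 tiles_rectangle_cross_3 by auto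
qed (rule cross_bent_strip_profile)

end
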